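(* Let $k\ge 1$ be an integer, and let $D$ be a $(2k-1)$-arc-strong semicomplete digraph on at least $2k+1$ vertices. Then $D$ contains a spanning $k$-arc-strong tournament, that is, there is a $k$-arc-strong tournament $T$ with $V(T)=V(D)$ and $A(T)\subseteq A(D)$.
   Context: Digraphs are finite, without loops and without parallel arcs; both arcs $xy$ and $yx$ may be present (they then form a directed 2-cycle). $V(D)$ and $A(D)$ denote the vertex set and arc set of $D$. A digraph $D$ is semicomplete if for every pair of distinct vertices $x,y$ at least one of the arcs $xy,yx$ is present. A tournament is a digraph in which exactly one of $xy,yx$ is present for every pair of distinct vertices $x,y$. For a positive integer $k$, a digraph $D$ is $k$-arc-strong if it remains strongly connected after the removal of any subset of $k-1$ arcs; equivalently, for every set $X$ with $\varnothing\ne X\subsetneq V(D)$, the number $d_D^-(X)$ of arcs $xy\in A(D)$ with $x\notin X$ and $y\in X$ is at least $k$. *)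

theory Defs
  imports "Graph_Theory.Digraph_Component"
begin

text \<open>
  The locale \<open>digraph\<close> of \<open>Graph_Theory\<close> is that of finite digraphs without loops and
  without parallel arcs; opposite arcs are allowed.
\<close>

definition semicomplete :: "('a, 'b) pre_digraph \<Rightarrow> bool" where
  "semicomplete G \<longleftrightarrow> digraph G \<and>
    (\<forall>x \<in> verts G. \<forall>y \<in> verts G. x \<noteq> y \<longrightarrow> x \<rightarrow>\<^bsub>G\<^esub> y \<or> y \<rightarrow>\<^bsub>G\<^esub> x)"

definition tournament :: "('a, 'b) pre_digraph \<Rightarrow> bool" where
  "tournament G \<longleftrightarrow> digraph G \<and>
    (\<forall>x \<in> verts G. \<forall>y \<in> verts G. x \<noteq> y \<longrightarrow> (x \<rightarrow>\<^bsub>G\<^esub> y \<longleftrightarrow> \<not> y \<rightarrow>\<^bsub>G\<^esub> x))"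

definition del_arcs :: "('a, 'b) pre_digraph \<Rightarrow> 'b set \<Rightarrow> ('a, 'b) pre_digraph" where
  "del_arcs G S = \<lparr> verts = verts G, arcs = arcs G - S, tail = tail G, head = head G \<rparr>"

text \<open>
  Removing at most, rather than exactly, \<open>k - 1\<close> arcs: the two agree when there are at least
  \<open>k - 1\<close> arcs, and the former is not vacuous when there are fewer.  The notion is
  meant for \<open>k \<ge> 1\<close>.
\<close>

definition arc_strong :: "nat \<Rightarrow> ('a, 'b) pre_digraph \<Rightarrow> bool" where
  "arc_strong k G \<longleftrightarrow>
    (\<forall>S \<subseteq> arcs G. card S \<le> k - 1 \<longrightarrow> strongly_connected (del_arcs G S))"

definition cut_arcs :: "('a, 'b) pre_digraph \<Rightarrow> 'a set \<Rightarrow> 'b set" where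
  "cut_arcs G X = {e \<in> arcs G. tail G e \<notin> X \<and> head G e \<in> X}"

lemma arc_strong_iff_cut:
  assumes "fin_digraph G" "verts G \<noteq> {}" "k \<ge> 1"
  shows "arc_strong k G \<longleftrightarrow>
    (\<forall>X. X \<noteq> {} \<and> X \<subset> verts G \<longrightarrow> k \<le> card (cut_arcs G X))"
proof (intro iffI allI impI)
  fix X assume G: "arc_strong k G" and X: "X \<noteq> {} \<and> X \<subset> verts G"
  show "k \<le> card (cut_arcs G X)"
  proof (rule ccontr)
    let ?H = "del_arcs G (cut_arcs G X)"
    assume "\<not> k \<le> card (cut_arcs G X)"
    then have H: "strongly_connected ?H"
      using G by (auto simp: arc_strong_def cut_arcs_def)
    obtain u v where uv: "u \<in> verts G" "u \<notin> X" "v \<in> X" "v \<in> verts G" using X by auto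
    then have "u \<rightarrow>\<^sup>*\<^bsub>?H\<^esub> v"
      using H by (auto simp: strongly_connected_def del_arcs_def)
    then have "(u, v) \<in> (arcs_ends ?H)\<^sup>*" by (rule reachable_rtranclI)
    then have "v \<notin> X"
      by induction (use uv in \<open>auto simp: arcs_ends_conv del_arcs_def cut_arcs_def\<close>)
    with uv show False by simp
  qed
next
  assume cut: "\<forall>X. X \<noteq> {} \<and> X \<subset> verts G \<longrightarrow> k \<le> card (cut_arcs G X)"
  interpret G: fin_digraph G by fact
  show "arc_strong k G"
    unfolding arc_strong_def
  proof (intro allI impI)
    fix S assume S: "S \<subseteq> arcs G" "card S \<le> k - 1"
    let ?H = "del_arcs G S"
    interpret H: wf_digraph ?H by unfold_locales (auto simp: del_arcs_def)
    have "u \<rightarrow>\<^sup>*\<^bsub>?H\<^esub> v" if uv: "u \<in> verts G" "v \<in> verts G" for u v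
    proof (rule ccontr)
      assume not_reach: "\<not> u \<rightarrow>\<^sup>*\<^bsub>?H\<^esub> v"
      define X where "X = {w \<in> verts G. \<not> u \<rightarrow>\<^sup>*\<^bsub>?H\<^esub> w}"
      have "u \<rightarrow>\<^sup>*\<^bsub>?H\<^esub> u"
        by (rule H.reachable_refl) (use uv in \<open>simp add: del_arcs_def\<close>)
      then have "u \<notin> X" by (simp add: X_def)
      moreover have "v \<in> X" using uv not_reach by (simp add: X_def)
      moreover have "X \<subseteq> verts G" unfolding X_def by blast
      ultimately have "k \<le> card (cut_arcs G X)" using cut uv by blast
      moreover have "cut_arcs G X \<subseteq> S"
      proof
        fix e assume e: "e \<in> cut_arcs G X"
        then have eX: "e \<in> arcs G" "tail G e \<notin> X" "head G e \<in> X"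
          by (simp_all add: cut_arcs_def)
        show "e \<in> S"
        proof (rule ccontr)
          assume "e \<notin> S"
          with eX have adj: "tail G e \<rightarrow>\<^bsub>?H\<^esub> head G e"
            by (force simp: del_arcs_def arcs_ends_conv)
          have "u \<rightarrow>\<^sup>*\<^bsub>?H\<^esub> tail G e" using eX by (simp add: X_def)
          then have "u \<rightarrow>\<^sup>*\<^bsub>?H\<^esub> head G e" using adj by (rule H.reachable_adj_trans)
          with eX show False by (simp add: X_def)
        qed
      qed
      moreover have "finite S" using S(1) G.finite_arcs by (rule finite_subset)
      ultimately have "k \<le> card S" by (meson card_mono le_trans)
      with S(2) \<open>k \<ge> 1\<close> show False by simp
    qed
    then show "strongly_connected ?H"
      using assms(2) unfolding strongly_connected_def by (simp add: del_arcs_def)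
  qed
qed

end

theory Submission
  imports Defs
begin

text \<open>
  In a tournament the number of arcs entering \<open>X\<close> is the sum of the indegrees over \<open>X\<close> minus
  \<open>|X|(|X| - 1)/2\<close>, so being \<open>k\<close>-arc-strong depends on the indegrees only, and the most balanced
  indegrees are the best.  Choose a spanning tournament \<open>T\<close> of \<open>D\<close> with least sum of squared
  indegrees.  Along a path of reversible arcs of \<open>T\<close> the indegree then grows by at most one in
  total, while a set closed under following reversible arcs has as many entering arcs in \<open>T\<close> as
  in \<open>D\<close>, hence at least \<open>2k - 1\<close> unless it is the whole vertex set.  Applied to the set reached
  from one vertex this bounds all indegrees below by \<open>k\<close>; applied to the set reached from a
  smallest cut \<open>X\<close> with fewer than \<open>k\<close> entering arcs it forces all indegrees outside \<open>X\<close> to be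
  \<open>|X|\<close>, and by symmetry all those inside to be \<open>|X| - 1\<close>, which leaves too many arcs entering \<open>X\<close>.
\<close>

section \<open>Cuts and indegrees of relations\<close>

definition entering :: "('a \<times> 'a) set \<Rightarrow> 'a set \<Rightarrow> ('a \<times> 'a) set" where
  "entering R X = R \<inter> (- X) \<times> X"

definition indeg :: "('a \<times> 'a) set \<Rightarrow> 'a \<Rightarrow> nat" where
  "indeg R v = card (R \<inter> UNIV \<times> {v})"

lemma card_off_diagonal:
  assumes "finite X"
  shows "card (X \<times> X - Id_on X) = card X * (card X - 1)"
proof -
  have eq: "Id_on X = (\<lambda>x. (x, x)) ` X" by auto
  have "card (Id_on X) = card X" unfolding eq by (rule card_image) (auto simp: inj_on_def)
  moreover have "card (X \<times> X - Id_on X) = card (X \<times> X) - card (Id_on X)"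
    by (rule card_Diff_subset) (use assms eq in auto)
  ultimately show ?thesis by (simp add: card_cartesian_product right_diff_distrib')
qed

lemma sum_indeg:
  assumes "finite R" "finite X"
  shows "(\<Sum>v\<in>X. indeg R v) = card (R \<inter> X \<times> X) + card (entering R X)"
proof -
  have "(\<Sum>v\<in>X. indeg R v) = card (\<Union>v\<in>X. R \<inter> UNIV \<times> {v})"
    unfolding indeg_def by (subst card_UN_disjoint) (use assms in auto)
  also have "(\<Union>v\<in>X. R \<inter> UNIV \<times> {v}) = R \<inter> X \<times> X \<union> entering R X"
    by (auto simp: entering_def)
  also have "card \<dots> = card (R \<inter> X \<times> X) + card (entering R X)"
    by (rule card_Un_disjoint) (use assms in \<open>auto simp: entering_def\<close>)
  finally show ?thesis .
qed

lemma entering_singleton: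
  assumes "(v, v) \<notin> R"
  shows "card (entering R {v}) = indeg R v"
  unfolding entering_def indeg_def by (rule arg_cong[where f = card]) (use assms in auto)

text \<open>Reversal exchanges entering and leaving arcs, and the arcs leaving \<open>X\<close> are
  those entering its complement.\<close>

lemma card_entering_converse:
  assumes "R \<subseteq> V \<times> V" "X \<subseteq> V"
  shows "card (entering (R\<inverse>) X) = card (entering R (V - X))"
proof -
  have "entering (R\<inverse>) X = (entering R (V - X))\<inverse>"
    using assms by (auto simp: entering_def)
  then show ?thesis by (simp add: card_inverse)
qed

text \<open>A walk from \<open>a\<close> that uses the arc \<open>(s, a)\<close> is back at
  \<open>a\<close> afterwards; dropping everything up to the last such return avoids the arc without
  lengthening the walk. So the rest of a walk survives the reversal of
  \<open>(s, a)\<close>.\<close>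

lemma relpow_diff_singleton:
  assumes "(a, t) \<in> R ^^ n" and sub: "R - {(s, a)} \<subseteq> S"
  shows "\<exists>m\<le>n. (a, t) \<in> S ^^ m"
  using assms(1)
proof (induction n arbitrary: t)
  case 0
  then show ?case by auto
next
  case (Suc n)
  then obtain w where w: "(a, w) \<in> R ^^ n" "(w, t) \<in> R" by auto
  show ?case
  proof (cases "(w, t) = (s, a)")
    case True
    then show ?thesis by (intro exI[of _ 0]) auto
  next
    case False
    obtain m where "m \<le> n" "(a, w) \<in> S ^^ m" using Suc.IH[OF w(1)] by auto
    then show ?thesis using w False sub by (intro exI[of _ "Suc m"]) auto
  qed
qed

section \<open>Spanning tournaments of a digraph, and reversal of arcs\<close>

locale sub_tournament =
  fixes V :: "'a set" and D T :: "('a \<times> 'a) set"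
  assumes finite_V: "finite V"
    and D_sub: "D \<subseteq> V \<times> V"
    and irrefl: "(v, v) \<notin> D"
    and T_sub: "T \<subseteq> D"
    and T_total: "x \<in> V \<Longrightarrow> y \<in> V \<Longrightarrow> x \<noteq> y \<Longrightarrow> (x, y) \<in> T \<longleftrightarrow> (y, x) \<notin> T"
begin

lemma finite_D: "finite D"
  using D_sub finite_V by (meson finite_SigmaI finite_subset)

lemma finite_T: "finite T"
  using finite_D T_sub finite_subset by blast

lemma T_asym: "(x, y) \<in> T \<Longrightarrow> (y, x) \<notin> T"
  using T_total[of x y] T_sub D_sub irrefl by auto

lemma sub_tournament_converse: "sub_tournament V (D\<inverse>) (T\<inverse>)"
proof
  fix x y assume "x \<in> V" "y \<in> V" "x \<noteq> y"
  then show "(x, y) \<in> T\<inverse> \<longleftrightarrow> (y, x) \<notin> T\<inverse>" using T_total[of y x] by auto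
qed (use finite_V D_sub irrefl T_sub in auto)

text \<open>The arcs inside \<open>X\<close> together with their reverses are all ordered pairs of
  distinct vertices of \<open>X\<close>. Doubling avoids halving natural numbers.\<close>

lemma sum_indeg_tournament:
  assumes "X \<subseteq> V"
  shows "2 * (\<Sum>v\<in>X. indeg T v) = card X * (card X - 1) + 2 * card (entering T X)"
proof -
  have X: "finite X" using assms finite_V finite_subset by blast
  let ?I = "T \<inter> X \<times> X"
  have fI: "finite ?I" using finite_T by simp
  have "(x, y) \<in> ?I \<union> ?I\<inverse> \<longleftrightarrow> (x, y) \<in> X \<times> X - Id_on X" for x y
    using T_total[of x y] irrefl T_sub assms by (cases "x = y") auto
  then have "?I \<union> ?I\<inverse> = X \<times> X - Id_on X" by auto
  moreover have "card (?I \<union> ?I\<inverse>) = card ?I + card (?I\<inverse>)"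
    by (rule card_Un_disjoint) (use fI T_asym in auto)
  ultimately have "2 * card ?I = card X * (card X - 1)"
    using card_off_diagonal[OF X] by (simp add: card_inverse)
  then show ?thesis using sum_indeg[OF finite_T X] by simp
qed

text \<open>The out-neighbours and the in-neighbours of \<open>v\<close> partition
  \<open>V - {v}\<close>.\<close>

lemma indeg_converse:
  assumes "v \<in> V"
  shows "indeg (T\<inverse>) v + indeg T v = card V - 1"
proof -
  have "indeg (T\<inverse>) v = card (T \<inter> {v} \<times> UNIV)"
    unfolding indeg_def by (subst card_inverse[symmetric]) (rule arg_cong[where f = card], auto)
  also have "\<dots> = card (snd ` (T \<inter> {v} \<times> UNIV))"
    by (rule card_image[symmetric]) (auto simp: inj_on_def)
  finally have o: "indeg (T\<inverse>) v = card (snd ` (T \<inter> {v} \<times> UNIV))" .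
  have i: "indeg T v = card (fst ` (T \<inter> UNIV \<times> {v}))"
    unfolding indeg_def by (rule card_image[symmetric]) (auto simp: inj_on_def)
  have "snd ` (T \<inter> {v} \<times> UNIV) \<union> fst ` (T \<inter> UNIV \<times> {v}) = V - {v}" (is "?A \<union> ?B = _")
  proof (intro set_eqI iffI)
    fix w assume "w \<in> ?A \<union> ?B"
    then show "w \<in> V - {v}" using T_sub D_sub irrefl by auto
  next
    fix w assume "w \<in> V - {v}"
    then have "(v, w) \<in> T \<or> (w, v) \<in> T" using T_total assms by blast
    then show "w \<in> ?A \<union> ?B" by force
  qed
  moreover have "card (?A \<union> ?B) = card ?A + card ?B"
  proof (rule card_Un_disjoint)
    show "?A \<inter> ?B = {}" using T_asym by auto
  qed (use finite_T in auto)
  ultimately show ?thesis using o i assms finite_V by simp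
qed

lemma flip:
  assumes "(s, a) \<in> T" "(a, s) \<in> D"
  defines "T' \<equiv> insert (a, s) (T - {(s, a)})"
  shows "sub_tournament V D T'"
    and "indeg T' s = Suc (indeg T s)"
    and "Suc (indeg T' a) = indeg T a"
    and "v \<noteq> s \<Longrightarrow> v \<noteq> a \<Longrightarrow> indeg T' v = indeg T v"
proof -
  have ne: "s \<noteq> a" using irrefl assms(2) by auto
  have nT: "(a, s) \<notin> T" using T_asym assms(1) .
  show "sub_tournament V D T'"
  proof
    fix x y assume "x \<in> V" "y \<in> V" "x \<noteq> y"
    then show "(x, y) \<in> T' \<longleftrightarrow> (y, x) \<notin> T'"
      using T_total[of x y] nT ne assms(1) unfolding T'_def by auto
  qed (use finite_V D_sub irrefl T_sub assms in auto)
  have "T' \<inter> UNIV \<times> {s} = insert (a, s) (T \<inter> UNIV \<times> {s})" using ne by (auto simp: T'_def)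
  then show "indeg T' s = Suc (indeg T s)" unfolding indeg_def using nT finite_T by simp
  have "T \<inter> UNIV \<times> {a} = insert (s, a) (T' \<inter> UNIV \<times> {a})"
    using ne assms(1) by (auto simp: T'_def)
  moreover have "(s, a) \<notin> T'" "finite T'" using ne finite_T by (auto simp: T'_def)
  ultimately show "Suc (indeg T' a) = indeg T a" unfolding indeg_def by simp
  show "indeg T' v = indeg T v" if "v \<noteq> s" "v \<noteq> a"
    unfolding indeg_def by (rule arg_cong[where f = card]) (use that in \<open>auto simp: T'_def\<close>)
qed

end

section \<open>Walks of reversible arcs in an optimal tournament\<close>

text \<open>
  \<open>T \<inter> D\<inverse>\<close> is the set of arcs of \<open>T\<close> that can be reversed inside \<open>D\<close>.  If the first arc of
  a path of such arcs increases the indegree, it does so by one, and reversing it preserves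
  optimality and shortens the path.
\<close>

lemma optimal_indeg_relpow:
  assumes opt: "\<And>T'. sub_tournament V D T' \<Longrightarrow>
      (\<Sum>v\<in>V. (indeg T v)\<^sup>2) \<le> (\<Sum>v\<in>V. (indeg T' v)\<^sup>2)"
    and "sub_tournament V D T"
    and "(s, t) \<in> (T \<inter> D\<inverse>) ^^ n"
  shows "indeg T t \<le> Suc (indeg T s)"
  using assms
proof (induction n arbitrary: T s rule: less_induct)
  case (less n)
  interpret sub_tournament V D T by fact
  show ?case
  proof (cases n)
    case 0
    then show ?thesis using less.prems by simp
  next
    case (Suc n')
    then obtain a where a: "(s, a) \<in> T" "(a, s) \<in> D" "(a, t) \<in> (T \<inter> D\<inverse>) ^^ n'"
      using less.prems(3) relpow_Suc_D2[of s t n' "T \<inter> D\<inverse>"] by blast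
    define T' where "T' = insert (a, s) (T - {(s, a)})"
    note fl = flip[OF a(1,2), folded T'_def]
    have sa: "s \<in> V" "a \<in> V" "s \<noteq> a" using a D_sub irrefl by auto
    have split: "(\<Sum>v\<in>V. f v) = f s + f a + (\<Sum>v\<in>V - {s, a}. f v)" for f :: "'a \<Rightarrow> nat"
    proof -
      have "(\<Sum>v\<in>V. f v) = (\<Sum>v\<in>{s, a}. f v) + (\<Sum>v\<in>V - {s, a}. f v)"
        by (subst sum.subset_diff[of "{s, a}"]) (use sa finite_V in auto)
      then show ?thesis using sa by simp
    qed
    have rest: "(\<Sum>v\<in>V - {s, a}. (indeg T' v)\<^sup>2) = (\<Sum>v\<in>V - {s, a}. (indeg T v)\<^sup>2)"
      by (rule sum.cong) (use fl(4) in auto)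
    \<comment> \<open>Reversing \<open>(s, a)\<close> moves one unit of indegree from
      \<open>a\<close> to \<open>s\<close>; a gap of two or more would make the sum of squares
      drop.\<close>
    have "(indeg T s)\<^sup>2 + (indeg T a)\<^sup>2 \<le> (Suc (indeg T s))\<^sup>2 + (indeg T' a)\<^sup>2"
      using less.prems(1)[OF fl(1)] rest fl(2) by (simp add: split)
    then have le: "indeg T a \<le> Suc (indeg T s)"
      unfolding fl(3)[symmetric] by (simp add: power2_eq_square)
    show ?thesis
    proof (cases "indeg T a \<le> indeg T s")
      case True
      then show ?thesis using less.IH[of n' T a] less.prems(1,2) a(3) Suc by fastforce
    next
      case False
      with le fl have eq: "indeg T a = Suc (indeg T s)" "indeg T' a = indeg T s" by auto
      have "T \<inter> D\<inverse> - {(s, a)} \<subseteq> T' \<inter> D\<inverse>" by (auto simp: T'_def)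
      then obtain m where m: "m \<le> n'" "(a, t) \<in> (T' \<inter> D\<inverse>) ^^ m"
        using relpow_diff_singleton[OF a(3)] by blast
      have "(\<Sum>v\<in>V. (indeg T' v)\<^sup>2) = (\<Sum>v\<in>V. (indeg T v)\<^sup>2)"
        using rest fl(2) eq by (simp add: split)
      then have opt': "(\<Sum>v\<in>V. (indeg T' v)\<^sup>2) \<le> (\<Sum>v\<in>V. (indeg T'' v)\<^sup>2)"
        if "sub_tournament V D T''" for T'' using less.prems(1) that by simp
      \<comment> \<open>In \<open>T'\<close> the vertex \<open>a\<close> has the old indegree of
        \<open>s\<close>, so the bound from \<open>a\<close> is the one sought, unless
        \<open>t\<close> is \<open>s\<close> or \<open>a\<close>, where the claim is
        immediate.\<close>
      then have "indeg T' t \<le> Suc (indeg T' a)"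
        using less.IH[of m T' a] opt' fl(1) m Suc by simp
      then show ?thesis using eq fl(4)[of t] by (cases "t = s"; cases "t = a") auto
    qed
  qed
qed

section \<open>Lower bounds on the indegrees and cuts of a balanced tournament\<close>

locale balanced_sub_tournament = sub_tournament +
  fixes k :: nat
  assumes k_pos: "k \<ge> 1"
    and card_V: "card V \<ge> 2 * k + 1"
    and D_cut: "X \<subseteq> V \<Longrightarrow> X \<noteq> {} \<Longrightarrow> X \<noteq> V \<Longrightarrow> 2 * k - 1 \<le> card (entering D X)"
    and balanced: "(s, t) \<in> (T \<inter> D\<inverse>)\<^sup>* \<Longrightarrow> indeg T t \<le> Suc (indeg T s)"
begin

text \<open>Reversal turns paths around and replaces each indegree on \<open>V\<close> by its
  complement to \<open>card V - 1\<close>; the two effects cancel in \<open>balanced\<close>. Later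
  arguments can thus be reused for outdegrees and complements.\<close>

lemma balanced_converse: "balanced_sub_tournament V (D\<inverse>) (T\<inverse>) k"
proof -
  interpret C: sub_tournament V "D\<inverse>" "T\<inverse>" by (rule sub_tournament_converse)
  show ?thesis
  proof
    fix X assume "X \<subseteq> V" "X \<noteq> {}" "X \<noteq> V"
    then show "2 * k - 1 \<le> card (entering (D\<inverse>) X)"
      using card_entering_converse[OF D_sub] D_cut[of "V - X"] by auto
  next
    fix s t assume "(s, t) \<in> (T\<inverse> \<inter> (D\<inverse>)\<inverse>)\<^sup>*"
    moreover have "T\<inverse> \<inter> (D\<inverse>)\<inverse> = (T \<inter> D\<inverse>)\<inverse>" by auto
    ultimately have ts: "(t, s) \<in> (T \<inter> D\<inverse>)\<^sup>*" by (simp add: rtrancl_converse)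
    show "indeg (T\<inverse>) t \<le> Suc (indeg (T\<inverse>) s)"
    \<comment> \<open>Only a path between distinct vertices is known to have its ends in
      \<open>V\<close>, as \<open>indeg_converse\<close> requires.\<close>
    proof (cases "s = t")
      case False
      then have "s \<in> V" "t \<in> V"
        using ts D_sub T_sub by (auto elim: rtranclE converse_rtranclE)
      then show ?thesis using balanced[OF ts] indeg_converse[of s] indeg_converse[of t] by linarith
    qed simp
  qed (use k_pos card_V in auto)
qed

lemma reach_sub:
  assumes "X \<subseteq> V"
  shows "(T \<inter> D\<inverse>)\<^sup>* `` X \<subseteq> V"
proof
  fix v assume "v \<in> (T \<inter> D\<inverse>)\<^sup>* `` X"
  then obtain u where "u \<in> X" "(u, v) \<in> (T \<inter> D\<inverse>)\<^sup>*" by auto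
  then show "v \<in> V" using assms D_sub by (auto elim: rtranclE)
qed

text \<open>If an arc of \<open>D\<close> enters the reached set but is not in \<open>T\<close>, its
  reverse is in \<open>T\<close> and reversible, so its tail is reached as well.\<close>

lemma entering_reach:
  assumes "X \<subseteq> V"
  shows "entering T ((T \<inter> D\<inverse>)\<^sup>* `` X) = entering D ((T \<inter> D\<inverse>)\<^sup>* `` X)" (is "?L = ?R")
proof
  show "?L \<subseteq> ?R" using T_sub by (auto simp: entering_def)
  show "?R \<subseteq> ?L"
  proof clarify
    fix u w assume e: "(u, w) \<in> ?R"
    then obtain x where x: "x \<in> X" "(x, w) \<in> (T \<inter> D\<inverse>)\<^sup>*" by (auto simp: entering_def)
    have uw: "u \<in> V" "w \<in> V" "u \<noteq> w" "(u, w) \<in> D"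
      using e D_sub irrefl by (auto simp: entering_def)
    have "(w, u) \<notin> T"
    proof
      assume "(w, u) \<in> T"
      then have "(x, u) \<in> (T \<inter> D\<inverse>)\<^sup>*" using x uw by (auto intro: rtrancl_into_rtrancl)
      then show False using e x by (auto simp: entering_def)
    qed
    then show "(u, w) \<in> ?L" using T_total[of u w] uw e by (auto simp: entering_def)
  qed
qed

text \<open>Otherwise the \<open>r\<close> vertices reached from \<open>v\<close> have indegree at
  most \<open>k\<close>, with \<open>v\<close> strictly below, so their sum is less than
  \<open>r * k\<close>. If they are all of \<open>V\<close>, the average \<open>(r - 1) / 2\<close>
  is too large; if not, the many arcs of \<open>D\<close> entering the set refute it for every
  \<open>r\<close>.\<close>

lemma indeg_ge:
  assumes v: "v \<in> V"
  shows "k \<le> indeg T v"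
proof (rule ccontr)
  assume "\<not> k \<le> indeg T v"
  then have small: "indeg T v < k" by simp
  define R where "R = (T \<inter> D\<inverse>)\<^sup>* `` {v}"
  have R: "R \<subseteq> V" "v \<in> R" using reach_sub[of "{v}"] v by (auto simp: R_def)
  have finR: "finite R" using R finite_V finite_subset by blast
  define r where "r = card R"
  have r1: "r \<ge> 1" using R finR by (auto simp: r_def Suc_le_eq card_gt_0_iff)
  have "(\<Sum>w\<in>R. indeg T w) < (\<Sum>w\<in>R. k)"
  proof (rule sum_strict_mono_ex1)
    show "\<forall>w\<in>R. indeg T w \<le> k"
      using small balanced[of v] by (fastforce simp: R_def)
  qed (use finR R small in auto)
  then have lt: "r * (r - 1) + 2 * card (entering T R) < 2 * (r * k)"
    using sum_indeg_tournament[OF R(1)] by (simp add: r_def)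
  show False
  proof (cases "R = V")
    case True
    then have "2 * k \<le> r - 1" using card_V r_def by simp
    then have "r * (2 * k) \<le> r * (r - 1)" by (rule mult_le_mono2)
    with lt show False by (simp add: algebra_simps)
  next
    case False
    have ent: "entering T R = entering D R"
      using entering_reach[of "{v}"] v by (simp add: R_def)
    define c where "c = card (entering D R)"
    have c1: "2 * k - 1 \<le> c" using D_cut[of R] R False by (auto simp: c_def)
    \<comment> \<open>Single vertices are cuts of \<open>D\<close> too, so
      \<open>D\<close>-indegrees are at least \<open>2 * k - 1\<close>; these arcs lie inside
      \<open>R\<close> or enter it.\<close>
    have "r * (2 * k - 1) = (\<Sum>w\<in>R. 2 * k - 1)" by (simp add: r_def)
    also have "\<dots> \<le> (\<Sum>w\<in>R. indeg D w)"
    proof (rule sum_mono)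
      fix w assume "w \<in> R"
      then have "{w} \<subseteq> V" "{w} \<noteq> V" using R card_V k_pos by auto
      then show "2 * k - 1 \<le> indeg D w"
        using D_cut[of "{w}"] entering_singleton[OF irrefl] by simp
    qed
    also have "\<dots> = card (D \<inter> R \<times> R) + c" using sum_indeg[OF finite_D finR] c_def by simp
    also have "card (D \<inter> R \<times> R) \<le> card (R \<times> R - Id_on R)"
      by (rule card_mono) (use finR irrefl in auto)
    also have "card (R \<times> R - Id_on R) = r * (r - 1)"
      unfolding r_def by (rule card_off_diagonal[OF finR])
    finally have c2: "r * (2 * k - 1) \<le> r * (r - 1) + c" by simp
    obtain j where j: "k = Suc j" using k_pos by (cases k) auto
    obtain q where q: "r = Suc q" using r1 by (cases r) auto
    have lt': "r * q + 2 * c < 2 * (r * k)" using lt ent q c_def by simp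
    show False
    \<comment> \<open>Three ranges of \<open>r\<close>. For \<open>r \<le> 2 * k - 1\<close> few
      arcs fit inside \<open>R\<close>, so \<open>c2\<close> makes \<open>c\<close> large. For
      \<open>r \<ge> 2 * k + 1\<close> the arcs inside suffice. For \<open>r = 2 * k\<close> one
      gets \<open>c < k\<close>, against \<open>c1\<close>.\<close>
    proof (cases "q \<le> 2 * j")
      case True
      have "2 * (r * (2 * j + 1)) \<le> 2 * (r * q) + 2 * c" using c2 j q by simp
      then have "2 * (r * (2 * j + 1)) < r * q + 2 * (r * k)" using lt' by linarith
      then have "r * (2 * (2 * j + 1)) < r * (q + 2 * k)" by (simp add: algebra_simps)
      then have "2 * (2 * j + 1) < q + 2 * k" using mult_less_cancel1 by blast
      then show False using True j by simp
    next
      case False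
      then have q1: "2 * j + 1 \<le> q" by simp
      show False
      proof (cases "q \<ge> 2 * k")
        case True
        then have "r * (2 * k) \<le> r * q" by (rule mult_le_mono2)
        then show False using lt' by linarith
      next
        case False
        then have "q = 2 * j + 1" using q1 j by simp
        then show False using lt' c1 q j by (simp add: algebra_simps)
      qed
    qed
  qed
qed

text \<open>By balance every vertex reached from \<open>X\<close> has indegree at most
  \<open>card X\<close>. Adding vertices of such indegree to \<open>X\<close> cannot enlarge the
  cut, whereas a proper reached set has a cut of at least \<open>2 * k - 1\<close>; hence all of
  \<open>V\<close> is reached.\<close>

lemma indeg_outside_eq:
  assumes X: "X \<subseteq> V" "card (entering T X) < k"
    and inside: "\<And>v. v \<in> X \<Longrightarrow> indeg T v < card X"
    and outside: "\<And>v. v \<in> V - X \<Longrightarrow> card X \<le> indeg T v"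
    and "X \<noteq> {}"
    and u: "u \<in> V - X"
  shows "indeg T u = card X"
proof -
  define R where "R = (T \<inter> D\<inverse>)\<^sup>* `` X"
  have R: "X \<subseteq> R" "R \<subseteq> V" using reach_sub[OF X(1)] by (auto simp: R_def)
  have finR: "finite R" using R finite_V finite_subset by blast
  have le: "indeg T w \<le> card X" if "w \<in> R" for w
    using that inside balanced by (fastforce simp: R_def)
  have "R = V"
  proof (rule ccontr)
    assume ne: "R \<noteq> V"
    have "card (entering T R) = card (entering D R)"
      using entering_reach[OF X(1)] by (simp add: R_def)
    also have "\<dots> \<ge> 2 * k - 1" using D_cut[of R] R ne \<open>X \<noteq> {}\<close> by blast
    finally have big: "k \<le> card (entering T R)" using k_pos by simp
    obtain y where y: "card R = card X + y"
      using card_mono[OF finR R(1)] by (metis le_Suc_ex)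
    have "(\<Sum>v\<in>R. indeg T v) = (\<Sum>v\<in>R - X. indeg T v) + (\<Sum>v\<in>X. indeg T v)"
      by (rule sum.subset_diff[OF R(1) finR])
    moreover have "(\<Sum>v\<in>R - X. indeg T v) \<le> (\<Sum>v\<in>R - X. card X)"
      by (rule sum_mono) (use le in auto)
    moreover have "card (R - X) = y"
      using y card_Diff_subset[of X R] R finR finite_subset by fastforce
    ultimately have "2 * (\<Sum>v\<in>R. indeg T v) \<le> 2 * (y * card X) + 2 * (\<Sum>v\<in>X. indeg T v)"
      by simp
    then have "card R * (card R - 1) + 2 * card (entering T R)
        \<le> 2 * (y * card X) + (card X * (card X - 1) + 2 * card (entering T X))"
      by (simp only: sum_indeg_tournament[OF R(2)] sum_indeg_tournament[OF X(1)])
    then have "card R * (card R - 1) < 2 * (y * card X) + card X * (card X - 1)"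
      using big X(2) by linarith
    moreover obtain x where x: "card X = Suc x"
      using \<open>X \<noteq> {}\<close> X(1) finite_V by (metis card_eq_0_iff finite_subset not0_implies_Suc)
    \<comment> \<open>Here \<open>card R = card X + y\<close>; expanding and cancelling leaves
      \<open>y * y < y\<close>.\<close>
    ultimately have "y * y < y \<and> y \<le> y * y" using y by (auto simp: algebra_simps)
    then show False by linarith
  qed
  then show ?thesis using le[of u] outside[of u] u by auto
qed

text \<open>
  Adding \<open>v\<close> to \<open>X\<close> changes the cut by \<open>indeg T v - card X\<close>, and removing it changes the cut by
  \<open>card X - 1 - indeg T v\<close>; so a minimum cut \<open>X\<close> separates the indegrees below \<open>card X\<close> from
  the others.
\<close>

lemma entering_ge:
  assumes "X \<subseteq> V" "X \<noteq> {}" "X \<noteq> V"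
  shows "k \<le> card (entering T X)"
proof (rule ccontr)
  assume bad: "\<not> k \<le> card (entering T X)"
  let ?P = "\<lambda>X. X \<subseteq> V \<and> X \<noteq> {} \<and> X \<noteq> V"
  interpret C: balanced_sub_tournament V "D\<inverse>" "T\<inverse>" k by (rule balanced_converse)
  obtain Y where Y: "?P Y" and min: "\<And>Z. ?P Z \<Longrightarrow> card (entering T Y) \<le> card (entering T Z)"
    using arg_min_nat_lemma[of ?P X "\<lambda>X. card (entering T X)"] assms by blast
  have finY: "finite Y" using Y finite_V finite_subset by blast
  have small: "card (entering T Y) < k" using min[of X] assms bad by simp
  define x where "x = card Y"
  define y where "y = card (V - Y)"
  have xy: "card V = x + y"
    using Y finite_V card_Diff_subset[of Y V] card_mono[of V Y] finY by (auto simp: x_def y_def)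
  have "x \<noteq> 0" "y \<noteq> 0" using Y finY finite_V by (auto simp: x_def y_def)
  have inside: "indeg T v < x" if v: "v \<in> Y" for v
  \<comment> \<open>Removing the only vertex would leave no cut to compare with; then the cut is the
    indegree of \<open>v\<close>, at least \<open>k\<close>.\<close>
  proof (cases "x = 1")
    case True
    then have "Y = {v}" using v unfolding x_def by (metis card_1_singletonE singletonD)
    then have "card (entering T Y) = indeg T v"
      using entering_singleton[of v T] irrefl T_sub by auto
    then show ?thesis using indeg_ge[of v] v Y small by auto
  next
    case False
    then have "Y \<noteq> {v}" using x_def by auto
    then have "Y - {v} \<noteq> {}" using v by auto
    then have "card (entering T Y) \<le> card (entering T (Y - {v}))" using min[of "Y - {v}"] Y v by blast
    moreover have "2 * (\<Sum>w\<in>Y. indeg T w) = 2 * indeg T v + 2 * (\<Sum>w\<in>Y - {v}. indeg T w)"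
      using sum.remove[OF finY v, of "indeg T"] by simp
    moreover have "card (Y - {v}) = x - 1" using v x_def by simp
    ultimately have "2 * indeg T v + (x - 1) * (x - 1 - 1) \<le> x * (x - 1)"
      using sum_indeg_tournament[of Y] sum_indeg_tournament[of "Y - {v}"] Y x_def by fastforce
    moreover obtain z where "x = Suc (Suc z)" using False \<open>x \<noteq> 0\<close> by (metis One_nat_def not0_implies_Suc)
    ultimately show ?thesis by (simp add: algebra_simps)
  qed
  have outside: "x \<le> indeg T v" if v: "v \<in> V - Y" for v
  \<comment> \<open>Dually, if \<open>v\<close> is the only vertex outside, the cut is its
    outdegree, which \<open>C.indeg_ge\<close> bounds.\<close>
  proof (cases "y = 1")
    case True
    then have "V - Y = {v}" using v unfolding y_def by (metis card_1_singletonE singletonD)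
    then have "card (entering (T\<inverse>) {v}) = card (entering T Y)"
      using card_entering_converse[of "T\<inverse>" V Y] T_sub D_sub Y by fastforce
    then have "card (entering T Y) = indeg (T\<inverse>) v"
      using entering_singleton[of v "T\<inverse>"] irrefl T_sub by auto
    then show ?thesis using C.indeg_ge[of v] v Y small by auto
  next
    case False
    have "insert v Y \<noteq> V"
    proof
      assume "insert v Y = V"
      then have "V - Y = {v}" using v by auto
      then show False using False y_def by simp
    qed
    then have "card (entering T Y) \<le> card (entering T (insert v Y))"
      using min[of "insert v Y"] Y v by blast
    moreover have "2 * (\<Sum>w\<in>insert v Y. indeg T w) = 2 * indeg T v + 2 * (\<Sum>w\<in>Y. indeg T w)"
      using finY v by simp
    moreover have "card (insert v Y) = x + 1" using v x_def finY by simp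
    ultimately have "(x + 1) * x \<le> 2 * indeg T v + x * (x - 1)"
      using sum_indeg_tournament[of Y] sum_indeg_tournament[of "insert v Y"] Y v x_def by fastforce
    moreover obtain z where "x = Suc z" using \<open>x \<noteq> 0\<close> by (metis not0_implies_Suc)
    ultimately show ?thesis by (simp add: algebra_simps)
  qed
  have out_eq: "indeg T v = x" if "v \<in> V - Y" for v
    using indeg_outside_eq[of Y v] Y small inside outside that by (auto simp: x_def)
  have in_eq: "indeg T v = x - 1" if v: "v \<in> Y" for v
  proof -
    \<comment> \<open>In the reversed tournament \<open>V - Y\<close> is the small cut, and
      \<open>inside\<close> and \<open>outside\<close> exchange roles.\<close>
    have "indeg (T\<inverse>) v = card (V - Y)"
    proof (rule C.indeg_outside_eq)
      have "V - (V - Y) = Y" using Y by auto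
      then show "card (entering (T\<inverse>) (V - Y)) < k"
        using card_entering_converse[of T V "V - Y"] T_sub D_sub small by auto
      show "indeg (T\<inverse>) w < card (V - Y)" if "w \<in> V - Y" for w
        using indeg_converse[of w] outside[OF that] that xy \<open>y \<noteq> 0\<close> y_def by auto
      show "card (V - Y) \<le> indeg (T\<inverse>) w" if "w \<in> V - (V - Y)" for w
        using indeg_converse[of w] inside[of w] that xy y_def by auto
    qed (use Y v in auto)
    then show ?thesis using indeg_converse[of v] v Y xy y_def \<open>x \<noteq> 0\<close> by auto
  qed
  have sY: "(\<Sum>v\<in>Y. indeg T v) = x * (x - 1)" using in_eq by (simp add: x_def)
  have cut: "x * (x - 1) = 2 * card (entering T Y)"
    using sum_indeg_tournament[of Y] Y sY by (simp add: x_def)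
  have entering_V: "entering T V = {}" using T_sub D_sub by (auto simp: entering_def)
  have "(\<Sum>v\<in>V. indeg T v) = (\<Sum>v\<in>V - Y. indeg T v) + (\<Sum>v\<in>Y. indeg T v)"
    by (rule sum.subset_diff) (use Y finite_V in auto)
  also have "(\<Sum>v\<in>V - Y. indeg T v) = y * x" using out_eq by (simp add: y_def)
  finally have "2 * (y * x + x * (x - 1)) = card V * (card V - 1)"
    using sum_indeg_tournament[of V] sY entering_V by simp
  moreover obtain z where z: "x = Suc z" using \<open>x \<noteq> 0\<close> by (metis not0_implies_Suc)
  \<comment> \<open>Counting all arcs gives this equation; \<open>z + y\<close> is
    \<open>card V - 1\<close>, which is positive, so it cancels. With \<open>x = y\<close> the size
    of \<open>V\<close> gives \<open>x \<ge> k + 1\<close>, and \<open>x * (x - 1) / 2\<close>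
    entering arcs are at least \<open>k\<close>.\<close>
  ultimately have "(2 * x) * (z + y) = (x + y) * (z + y)" using xy by (simp add: algebra_simps)
  then have "x = y" using \<open>y \<noteq> 0\<close> by simp
  then have "k + 1 \<le> x" using card_V xy by simp
  then have "(k + 1) * k \<le> x * (x - 1)" by (intro mult_le_mono) auto
  moreover have "k * 2 \<le> (k + 1) * k" using k_pos by (simp add: algebra_simps)
  ultimately show False using cut small by linarith
qed

end

section \<open>Existence of an optimal tournament and return to digraphs with named arcs\<close>

lemma exists_sub_tournament:
  assumes "finite V" "D \<subseteq> V \<times> V" "\<And>v. (v, v) \<notin> D"
    and semi: "\<And>x y. x \<in> V \<Longrightarrow> y \<in> V \<Longrightarrow> x \<noteq> y \<Longrightarrow> (x, y) \<in> D \<or> (y, x) \<in> D"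
  shows "\<exists>T. sub_tournament V D T"
proof -
  obtain f :: "'a \<Rightarrow> nat" where f: "inj_on f V"
    using finite_imp_inj_to_nat_seg[OF assms(1)] by blast
  \<comment> \<open>Each directed 2-cycle is broken by an arbitrary numbering of the
    vertices.\<close>
  have "sub_tournament V D {(x, y) \<in> D. (y, x) \<in> D \<longrightarrow> f x < f y}"
  proof
    fix x y assume xy: "x \<in> V" "y \<in> V" "x \<noteq> y"
    then have "f x \<noteq> f y" using f by (auto simp: inj_on_def)
    then show "(x, y) \<in> {(x, y) \<in> D. (y, x) \<in> D \<longrightarrow> f x < f y} \<longleftrightarrow>
        (y, x) \<notin> {(x, y) \<in> D. (y, x) \<in> D \<longrightarrow> f x < f y}"
      using semi[OF xy] by auto
  qed (use assms in auto)
  then show ?thesis by blast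
qed

lemma exists_sub_tournament_entering_ge:
  assumes "finite V" "D \<subseteq> V \<times> V" "\<And>v. (v, v) \<notin> D"
    and "\<And>x y. x \<in> V \<Longrightarrow> y \<in> V \<Longrightarrow> x \<noteq> y \<Longrightarrow> (x, y) \<in> D \<or> (y, x) \<in> D"
    and "k \<ge> 1" "card V \<ge> 2 * k + 1"
    and "\<And>X. X \<subseteq> V \<Longrightarrow> X \<noteq> {} \<Longrightarrow> X \<noteq> V \<Longrightarrow> 2 * k - 1 \<le> card (entering D X)"
  shows "\<exists>T. sub_tournament V D T \<and>
    (\<forall>X. X \<subseteq> V \<and> X \<noteq> {} \<and> X \<noteq> V \<longrightarrow> k \<le> card (entering T X))"
proof -
  obtain T0 where "sub_tournament V D T0" using exists_sub_tournament[OF assms(1-4)] by blast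
  then obtain T where T: "sub_tournament V D T"
    and opt: "\<And>T'. sub_tournament V D T' \<Longrightarrow>
      (\<Sum>v\<in>V. (indeg T v)\<^sup>2) \<le> (\<Sum>v\<in>V. (indeg T' v)\<^sup>2)"
    using arg_min_nat_lemma[of "sub_tournament V D" T0 "\<lambda>T. \<Sum>v\<in>V. (indeg T v)\<^sup>2"] by blast
  interpret sub_tournament V D T by fact
  have "balanced_sub_tournament V D T k"
  proof
    fix s t assume "(s, t) \<in> (T \<inter> D\<inverse>)\<^sup>*"
    then obtain n where "(s, t) \<in> (T \<inter> D\<inverse>) ^^ n" by (auto simp: rtrancl_power)
    then show "indeg T t \<le> Suc (indeg T s)" using optimal_indeg_relpow opt T by metis
  qed (use assms in auto)
  then show ?thesis using T balanced_sub_tournament.entering_ge by blast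
qed

text \<open>Without parallel arcs an arc is determined by its ends, so cuts may be counted in the
  relation \<open>arcs_ends G\<close>.\<close>

lemma (in digraph) card_cut_arcs: "card (cut_arcs G X) = card (entering (arcs_ends G) X)"
proof -
  have "entering (arcs_ends G) X = arc_to_ends G ` cut_arcs G X"
    by (auto simp: entering_def cut_arcs_def arcs_ends_def arc_to_ends_def)
  moreover have "inj_on (arc_to_ends G) (cut_arcs G X)"
    using no_multi_arcs by (auto simp: inj_on_def cut_arcs_def)
  ultimately show ?thesis by (simp add: card_image)
qed

theorem theorem1p3:
  fixes D :: "('a, 'b) pre_digraph" and k :: nat
  assumes "k \<ge> 1"
    and "semicomplete D"
    and "arc_strong (2 * k - 1) D"
    and "card (verts D) \<ge> 2 * k + 1"
  shows "\<exists>T :: ('a, 'b) pre_digraph. tournament T \<and> arc_strong k T \<and> spanning T D"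
proof -
  interpret D: digraph D using assms(2) by (simp add: semicomplete_def)
  have ne: "verts D \<noteq> {}" using assms(4) by auto
  have cut: "\<forall>X. X \<noteq> {} \<and> X \<subset> verts D \<longrightarrow> 2 * k - 1 \<le> card (cut_arcs D X)"
    using arc_strong_iff_cut[of D "2 * k - 1"] D.fin_digraph_axioms ne assms(1,3) by auto
  have "\<exists>R. sub_tournament (verts D) (arcs_ends D) R \<and>
      (\<forall>X. X \<subseteq> verts D \<and> X \<noteq> {} \<and> X \<noteq> verts D \<longrightarrow> k \<le> card (entering R X))"
  proof (rule exists_sub_tournament_entering_ge)
    show "arcs_ends D \<subseteq> verts D \<times> verts D" by (auto simp: arcs_ends_conv)
    show "(v, v) \<notin> arcs_ends D" for v using D.adj_not_same by blast
    show "(x, y) \<in> arcs_ends D \<or> (y, x) \<in> arcs_ends D"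
      if "x \<in> verts D" "y \<in> verts D" "x \<noteq> y" for x y
      using assms(2) that by (auto simp: semicomplete_def)
    show "2 * k - 1 \<le> card (entering (arcs_ends D) X)"
      if "X \<subseteq> verts D" "X \<noteq> {}" "X \<noteq> verts D" for X
      using cut that D.card_cut_arcs by auto
  qed (use assms in auto)
  then obtain R where "sub_tournament (verts D) (arcs_ends D) R"
    and R_cut: "\<And>X. X \<noteq> {} \<and> X \<subset> verts D \<Longrightarrow> k \<le> card (entering R X)" by blast
  then interpret R: sub_tournament "verts D" "arcs_ends D" R by simp
  define T where "T = D\<lparr>arcs := {e \<in> arcs D. (tail D e, head D e) \<in> R}\<rparr>"
  have ends: "arcs_ends T = R"
    using R.T_sub by (auto simp: T_def arcs_ends_conv)
  interpret T: digraph T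
  proof
    fix e f assume "e \<in> arcs T" "f \<in> arcs T" "arc_to_ends T e = arc_to_ends T f"
    then show "e = f" using D.no_multi_arcs[of e f] by (simp add: T_def arc_to_ends_def)
  qed (use D.no_loops in \<open>simp_all add: T_def\<close>)
  have verts: "verts T = verts D" by (simp add: T_def)
  have "tournament T"
    unfolding tournament_def ends verts by (intro conjI ballI impI T.digraph_axioms R.T_total)
  moreover have "arc_strong k T"
    using arc_strong_iff_cut[of T k] T.fin_digraph_axioms assms(1) ne R_cut
    by (simp add: T.card_cut_arcs ends verts)
  moreover have "spanning T D"
    unfolding spanning_def subgraph_def compatible_def
    using D.wf_digraph_axioms T.wf_digraph_axioms by (auto simp: T_def)
  ultimately show ?thesis by blast
qed

end
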